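(* Let $(M,d)$ be a nonempty hyperconvex metric space. If a group $G$ acts on $M$ by isometries $\{T_a : a\in G\}$ and all orbits $O(x)=\{T_a x: a\in G\}$, $x\in M$, are bounded, then $\operatorname{Fix} G=\{x\in M : T_a x=x \text{ for all } a\in G\}$ is nonempty. In particular, if $M$ is bounded, then there exists a point of $M$ which is a common fixed point of all surjective isometries $M\to M$.
   Context: A metric space $(M,d)$ is called hyperconvex if $\bigcap_{\alpha\in\Gamma}B(x_\alpha,r_\alpha)\neq\emptyset$ for any collection of closed balls $\{B(x_\alpha,r_\alpha)\}_{\alpha\in\Gamma}$ in $M$ (with $r_\alpha\ge 0$) such that $d(x_\alpha,x_\beta)\le r_\alpha+r_\beta$ for all $\alpha,\beta\in\Gamma$; here $B(x,r)=\{y\in M: d(x,y)\le r\}$. A group $G$ with identity $e$ acts on $M$ by maps $T_a:M\to M$, $a\in G$, if $T_a(T_b x)=T_{ab}x$ and $T_e x=x$ for all $a,b\in G$, $x\in M$. An isometry is a distance-preserving map. *)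

theory Defs
  imports "HOL-Analysis.Abstract_Metric_Spaces" "HOL-Algebra.Group_Action"
begin

context Metric_space
begin

text \<open>A family of closed balls is given by its set \<open>C\<close> of (centre, radius) pairs; since neither
  the hypothesis nor the conclusion depends on how the family is indexed, this covers index sets of
  every size. The intersection is taken inside \<open>M\<close>, so for the empty family it is \<open>M\<close> itself.\<close>

definition hyperconvex :: bool where
  "hyperconvex \<longleftrightarrow>
    (\<forall>C \<subseteq> M \<times> {0..}.
       (\<forall>(x, r) \<in> C. \<forall>(y, s) \<in> C. d x y \<le> r + s) \<longrightarrow>
       M \<inter> (\<Inter>(x, r) \<in> C. mcball x r) \<noteq> {})"

definition isometry :: "('a \<Rightarrow> 'a) \<Rightarrow> bool" where
  "isometry f \<longleftrightarrow> f \<in> M \<rightarrow> M \<and> (\<forall>x\<in>M. \<forall>y\<in>M. d (f x) (f y) = d x y)"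

end

text \<open>Unlike \<^locale>\<open>group_action\<close>, which takes \<open>T a\<close> to be a member of \<^term>\<open>Bij M\<close>,
  this does not require the maps to be extensional: only their values on \<open>M\<close> matter.\<close>

definition acts_on :: "('g, 'k) monoid_scheme \<Rightarrow> 'a set \<Rightarrow> ('g \<Rightarrow> 'a \<Rightarrow> 'a) \<Rightarrow> bool" where
  "acts_on G M T \<longleftrightarrow>
    (\<forall>a \<in> carrier G. T a \<in> M \<rightarrow> M) \<and>
    (\<forall>a \<in> carrier G. \<forall>b \<in> carrier G. \<forall>x \<in> M. T a (T b x) = T (a \<otimes>\<^bsub>G\<^esub> b) x) \<and>
    (\<forall>x \<in> M. T \<one>\<^bsub>G\<^esub> x = x)"

definition Fix :: "('g, 'k) monoid_scheme \<Rightarrow> 'a set \<Rightarrow> ('g \<Rightarrow> 'a \<Rightarrow> 'a) \<Rightarrow> 'a set" where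
  "Fix G M T = {x \<in> M. \<forall>a \<in> carrier G. T a x = x}"

end

theory Submission
  imports Defs
begin

text \<open>Start from a bounded set \<open>S\<close> which is invariant under the maps in question (an orbit, or \<open>M\<close>
  itself) and let \<open>A\<^sub>0\<close> be the set of points within \<open>R\<close> of all of \<open>S\<close>, where \<open>R\<close> bounds the distances
  in \<open>S\<close>. Given an intersection of balls \<open>A\<^sub>n\<close> of diameter at most \<open>\<delta>\<close>, cut it down by the balls of
  radius \<open>\<delta>/2\<close> about its own points: by hyperconvexity the result \<open>A\<^sub>n\<^sub>+\<^sub>1\<close> is nonempty, and two of its
  points are within \<open>\<delta>/2\<close>, as each is the centre of a ball containing the other. Any two of the
  balls used in the whole construction meet, so hyperconvexity gives a point in all \<open>A\<^sub>n\<close>. It is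
  unique, because the diameters tend to zero, hence fixed, because each \<open>A\<^sub>n\<close> is invariant.\<close>

context Metric_space
begin

text \<open>Membership is expressed by distance bounds alone, without the condition on centres built
  into \<open>mcball\<close>; the empty family gives \<open>M\<close>.\<close>

definition ball_Inter :: "('a \<times> real) set \<Rightarrow> 'a set" where
  "ball_Inter C = {y \<in> M. \<forall>(x, r) \<in> C. d x y \<le> r}"

lemma ball_Inter_subset: "ball_Inter C \<subseteq> M"
  by (auto simp: ball_Inter_def)

lemma ball_InterD: "y \<in> ball_Inter C \<Longrightarrow> (x, r) \<in> C \<Longrightarrow> d x y \<le> r"
  by (auto simp: ball_Inter_def)

lemma hyperconvex_ball_Inter:
  assumes "hyperconvex" "C \<subseteq> M \<times> {0..}"
    and "\<And>x r y s. (x, r) \<in> C \<Longrightarrow> (y, s) \<in> C \<Longrightarrow> d x y \<le> r + s"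
  shows "ball_Inter C \<noteq> {}"
proof -
  have "M \<inter> (\<Inter>(x, r) \<in> C. mcball x r) \<noteq> {}"
    using assms(1)[unfolded hyperconvex_def, rule_format, OF assms(2)] assms(3)
    by (simp add: case_prod_beta)
  moreover have "M \<inter> (\<Inter>(x, r) \<in> C. mcball x r) \<subseteq> ball_Inter C"
    by (force simp: ball_Inter_def)
  ultimately show ?thesis by blast
qed

text \<open>Triangle inequality through a common point. It turns nonemptiness of one stage back into
  the pairwise hypothesis of hyperconvexity.\<close>

lemma ball_Inter_nonempty_pairwise:
  assumes "ball_Inter C \<noteq> {}" "C \<subseteq> M \<times> {0..}" "(x, r) \<in> C" "(y, s) \<in> C"
  shows "d x y \<le> r + s"
proof -
  obtain z where z: "z \<in> ball_Inter C" using assms(1) by blast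
  have "x \<in> M" "y \<in> M" "z \<in> M" using assms z ball_Inter_subset by auto
  then have "d x y \<le> d x z + d y z"
    by (metis commute triangle)
  then show ?thesis using ball_InterD[OF z assms(3)] ball_InterD[OF z assms(4)] by linarith
qed

lemma isometry_image_ball_Inter:
  assumes f: "isometry f" "f ` M = M" and C: "C \<subseteq> M \<times> {0..}" "map_prod f id ` C = C"
  shows "f ` ball_Inter C = ball_Inter C"
proof -
  have *: "f y \<in> ball_Inter C \<longleftrightarrow> y \<in> ball_Inter C" if y: "y \<in> M" for y
  proof -
    \<comment> \<open>Writing \<open>C\<close> as its own image gives every centre the form
      \<open>f x\<close>, so that the isometry property applies.\<close>
    have "f y \<in> ball_Inter C \<longleftrightarrow> (\<forall>(x, r) \<in> map_prod f id ` C. d x (f y) \<le> r)"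
      using f y by (auto simp: ball_Inter_def C(2))
    also have "\<dots> \<longleftrightarrow> (\<forall>(x, r) \<in> C. d (f x) (f y) \<le> r)"
      by auto
    also have "\<dots> \<longleftrightarrow> (\<forall>(x, r) \<in> C. d x y \<le> r)"
      using f(1) C(1) y by (intro ball_cong) (auto simp: isometry_def)
    also have "\<dots> \<longleftrightarrow> y \<in> ball_Inter C" using y by (auto simp: ball_Inter_def)
    finally show ?thesis .
  qed
  show ?thesis
  proof
    show "f ` ball_Inter C \<subseteq> ball_Inter C" using * ball_Inter_subset by blast
    show "ball_Inter C \<subseteq> f ` ball_Inter C"
    proof
      fix z assume z: "z \<in> ball_Inter C"
      then obtain y where "y \<in> M" "z = f y" using f(2) ball_Inter_subset by blast
      with z * show "z \<in> f ` ball_Inter C" by blast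
    qed
  qed
qed

text \<open>The radius \<open>R / 2 ^ n\<close> is half the diameter bound of stage
  \<open>n\<close>. Earlier balls are kept, so any two balls of the union over all stages lie in a
  common stage.\<close>

primrec shrinking_balls :: "'a set \<Rightarrow> real \<Rightarrow> nat \<Rightarrow> ('a \<times> real) set" where
  "shrinking_balls S R 0 = S \<times> {R}"
| "shrinking_balls S R (Suc n) =
     shrinking_balls S R n \<union> ball_Inter (shrinking_balls S R n) \<times> {R / 2 ^ n}"

lemma shrinking_balls_subset:
  assumes "S \<subseteq> M" "0 \<le> R"
  shows "shrinking_balls S R n \<subseteq> M \<times> {0..}"
proof (induction n)
  case 0
  then show ?case using assms by auto
next
  case (Suc n)
  have "ball_Inter (shrinking_balls S R n) \<times> {R / 2 ^ n} \<subseteq> M \<times> {0..}"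
    using ball_Inter_subset assms(2) by fastforce
  then show ?case using Suc by simp
qed

lemma shrinking_balls_mono: "m \<le> n \<Longrightarrow> shrinking_balls S R m \<subseteq> shrinking_balls S R n"
  by (rule lift_Suc_mono_le) auto

text \<open>At stage 0 both points are within \<open>R\<close> of a point of \<open>S\<close>. At
  stage \<open>Suc m\<close> the point \<open>x\<close> is itself the centre of a ball of radius
  \<open>R / 2 ^ m\<close> containing \<open>y\<close>.\<close>

lemma ball_Inter_shrinking_balls_diameter:
  assumes "S \<subseteq> M" "S \<noteq> {}"
    and "x \<in> ball_Inter (shrinking_balls S R n)" "y \<in> ball_Inter (shrinking_balls S R n)"
  shows "d x y \<le> 2 * R / 2 ^ n"
proof (cases n)
  case 0
  obtain s where s: "s \<in> S" using assms(2) by blast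
  then have "d s x \<le> R" "d s y \<le> R" using assms(3,4) 0 by (auto dest: ball_InterD)
  moreover have "d x y \<le> d s x + d s y"
    using s assms ball_Inter_subset by (metis commute subsetD triangle)
  ultimately show ?thesis using 0 by simp
next
  case (Suc m)
  have "x \<in> ball_Inter (shrinking_balls S R m)"
    using assms(3) Suc by (auto simp: ball_Inter_def)
  then have "(x, R / 2 ^ m) \<in> shrinking_balls S R n" using Suc by simp
  then have "d x y \<le> R / 2 ^ m" by (rule ball_InterD[OF assms(4)])
  then show ?thesis using Suc by simp
qed

lemma ball_Inter_shrinking_balls_nonempty:
  assumes "hyperconvex" "S \<subseteq> M" "S \<noteq> {}" "0 \<le> R"
    and R: "\<And>x y. x \<in> S \<Longrightarrow> y \<in> S \<Longrightarrow> d x y \<le> R"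
  shows "ball_Inter (shrinking_balls S R n) \<noteq> {}"
proof (induction n)
  case 0
  \<comment> \<open>Every point of \<open>S\<close> is a witness, since \<open>R\<close> bounds the
    distances in \<open>S\<close>.\<close>
  then show ?case using assms by (auto simp: ball_Inter_def)
next
  case (Suc n)
  let ?C = "shrinking_balls S R n"
  have C: "?C \<subseteq> M \<times> {0..}" using assms shrinking_balls_subset by blast
  have R_nonneg: "0 \<le> R / 2 ^ n" using assms by simp
  show ?case
  proof (rule hyperconvex_ball_Inter)
    show "hyperconvex" by fact
    show "shrinking_balls S R (Suc n) \<subseteq> M \<times> {0..}" using assms shrinking_balls_subset by blast
  next
    fix x r y s
    assume x: "(x, r) \<in> shrinking_balls S R (Suc n)" and y: "(y, s) \<in> shrinking_balls S R (Suc n)"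
    consider "(x, r) \<in> ?C" "(y, s) \<in> ?C"
      | "(x, r) \<in> ?C" "y \<in> ball_Inter ?C" "s = R / 2 ^ n"
      | "x \<in> ball_Inter ?C" "r = R / 2 ^ n" "(y, s) \<in> ?C"
      | "x \<in> ball_Inter ?C" "r = R / 2 ^ n" "y \<in> ball_Inter ?C" "s = R / 2 ^ n"
      using x y by auto
    then show "d x y \<le> r + s"
    proof cases
      case 1
      then show ?thesis using ball_Inter_nonempty_pairwise[OF Suc C] by blast
    next
      case 2
      \<comment> \<open>The new centre \<open>y\<close> already lies in the old ball about
        \<open>x\<close>.\<close>
      then show ?thesis using ball_InterD[of y ?C x r] R_nonneg by simp
    next
      case 3
      then show ?thesis using ball_InterD[of x ?C y s] R_nonneg commute[of x y] by simp
    next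
      case 4
      \<comment> \<open>The two new radii add up to exactly the diameter bound.\<close>
      then show ?thesis using ball_Inter_shrinking_balls_diameter[of S x R n y] assms by simp
    qed
  qed
qed

text \<open>An invariant family has an invariant intersection, and the points of that intersection
  are the centres added next.\<close>

lemma shrinking_balls_invariant:
  assumes "isometry f" "f ` M = M" "S \<subseteq> M" "f ` S = S" "0 \<le> R"
  shows "map_prod f id ` shrinking_balls S R n = shrinking_balls S R n"
proof (induction n)
  case 0
  then show ?case using assms(4) by (simp add: map_prod_surj_on)
next
  case (Suc n)
  have "f ` ball_Inter (shrinking_balls S R n) = ball_Inter (shrinking_balls S R n)"
    by (rule isometry_image_ball_Inter[OF assms(1,2) shrinking_balls_subset[OF assms(3,5)] Suc])
  then show ?case using Suc by (simp add: image_Un map_prod_surj_on)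
qed

text \<open>The point depends on \<open>S\<close> only, so one \<open>x\<close> serves all
  \<open>f\<close> at once. An orbit and \<open>M\<close> itself are the two choices of
  \<open>S\<close> used below.\<close>

theorem hyperconvex_common_fixed_point:
  assumes "hyperconvex" "mbounded S" "S \<noteq> {}"
  obtains x where "x \<in> M" "\<And>f. isometry f \<Longrightarrow> f ` M = M \<Longrightarrow> f ` S = S \<Longrightarrow> f x = x"
proof -
  obtain R where S: "S \<subseteq> M" and R: "\<And>x y. x \<in> S \<Longrightarrow> y \<in> S \<Longrightarrow> d x y \<le> R"
    using assms(2) by (auto simp: mbounded_alt)
  have R0: "0 \<le> R" using assms(3) R nonneg order_trans by blast
  let ?C = "\<lambda>n. shrinking_balls S R n"
  have C: "?C n \<subseteq> M \<times> {0..}" for n using S R0 by (rule shrinking_balls_subset)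
  have "ball_Inter (\<Union>n. ?C n) \<noteq> {}"
  proof (rule hyperconvex_ball_Inter)
    show "hyperconvex" by fact
    show "(\<Union>n. ?C n) \<subseteq> M \<times> {0..}" using C by blast
  next
    fix x r y s
    assume "(x, r) \<in> (\<Union>n. ?C n)" "(y, s) \<in> (\<Union>n. ?C n)"
    then obtain m n where "(x, r) \<in> ?C m" "(y, s) \<in> ?C n" by blast
    then have "(x, r) \<in> ?C (max m n)" "(y, s) \<in> ?C (max m n)"
      using shrinking_balls_mono max.cobounded1 max.cobounded2 by blast+
    then show "d x y \<le> r + s"
      using ball_Inter_nonempty_pairwise C
        ball_Inter_shrinking_balls_nonempty[OF assms(1) S assms(3) R0 R] by blast
  qed
  then obtain x where x: "x \<in> ball_Inter (\<Union>n. ?C n)" by blast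
  then have xn: "x \<in> ball_Inter (?C n)" for n by (auto simp: ball_Inter_def)
  have "x \<in> M" using x ball_Inter_subset by blast
  moreover have "f x = x" if f: "isometry f" "f ` M = M" "f ` S = S" for f
  proof -
    \<comment> \<open>Both \<open>x\<close> and \<open>f x\<close> lie in every stage, whose
      diameters tend to 0.\<close>
    have "f x \<in> ball_Inter (?C n)" for n
      using isometry_image_ball_Inter[OF f(1,2) C] shrinking_balls_invariant[OF f(1,2) S f(3) R0]
        xn by blast
    then have "d (f x) x \<le> 2 * R / 2 ^ n" for n
      using ball_Inter_shrinking_balls_diameter[OF S assms(3)] xn by blast
    moreover have "(\<lambda>n. 2 * R / 2 ^ n) \<longlonglongrightarrow> 0"
      by (rule LIMSEQ_divide_realpow_zero) simp
    ultimately have "d (f x) x \<le> 0" by (intro LIMSEQ_le_const) auto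
    moreover have "f x \<in> M" using f(2) \<open>x \<in> M\<close> by blast
    ultimately show ?thesis using \<open>x \<in> M\<close> nonneg[of "f x" x] zero[of "f x" x] by simp
  qed
  ultimately show thesis by (rule that)
qed

end

text \<open>The inverse of \<open>a\<close> supplies preimages, so the maps of an action are
  surjective.\<close>

lemma acts_on_image_eq:
  assumes "group G" "acts_on G M T" "a \<in> carrier G"
  shows "T a ` M = M"
proof
  show "T a ` M \<subseteq> M" using assms by (auto simp: acts_on_def)
  show "M \<subseteq> T a ` M"
  proof
    fix x assume x: "x \<in> M"
    have a: "inv\<^bsub>G\<^esub> a \<in> carrier G" using assms by (simp add: group.inv_closed)
    then have "T a (T (inv\<^bsub>G\<^esub> a) x) = x"
      using assms x by (simp add: acts_on_def group.r_inv)
    moreover have "T (inv\<^bsub>G\<^esub> a) x \<in> M" using assms a x by (auto simp: acts_on_def)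
    ultimately show "x \<in> T a ` M" by (metis imageI)
  qed
qed

text \<open>Left multiplication by \<open>a\<close> permutes the group and so only reindexes the
  orbit.\<close>

lemma acts_on_image_orbit:
  assumes "group G" "acts_on G M T" "a \<in> carrier G" "x \<in> M"
  shows "T a ` Group_Action.orbit G T x = Group_Action.orbit G T x"
proof -
  interpret group G by fact
  have orbit: "Group_Action.orbit G T x = (\<lambda>b. T b x) ` carrier G"
    unfolding orbit_def by blast
  have "T a ` Group_Action.orbit G T x = (\<lambda>b. T (a \<otimes>\<^bsub>G\<^esub> b) x) ` carrier G"
    unfolding orbit image_image using assms by (intro image_cong) (simp_all add: acts_on_def)
  also have "\<dots> = (\<lambda>b. T b x) ` ((\<lambda>b. a \<otimes>\<^bsub>G\<^esub> b) ` carrier G)"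
    by (simp add: image_image)
  also have "\<dots> = Group_Action.orbit G T x"
    unfolding orbit surj_const_mult[OF assms(3)] ..
  finally show ?thesis .
qed

theorem corollary2p5:
  fixes M :: "'a set" and d :: "'a \<Rightarrow> 'a \<Rightarrow> real"
  assumes "Metric_space M d"
    and "M \<noteq> {}"
    and "Metric_space.hyperconvex M d"
  shows "(\<forall>(G :: ('g, 'k) monoid_scheme) (T :: 'g \<Rightarrow> 'a \<Rightarrow> 'a).
            group G \<and> acts_on G M T \<and>
            (\<forall>a \<in> carrier G. Metric_space.isometry M d (T a)) \<and>
            (\<forall>x \<in> M. Metric_space.mbounded M d (Group_Action.orbit G T x))
            \<longrightarrow> Fix G M T \<noteq> {}) \<and>
         (Metric_space.mbounded M d M \<longrightarrow>
            (\<exists>x \<in> M. \<forall>f. Metric_space.isometry M d f \<and> f ` M = M \<longrightarrow> f x = x))"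
proof (intro conjI allI impI)
  interpret Metric_space M d by fact
  fix G :: "('g, 'k) monoid_scheme" and T :: "'g \<Rightarrow> 'a \<Rightarrow> 'a"
  assume *: "group G \<and> acts_on G M T \<and> (\<forall>a \<in> carrier G. isometry (T a)) \<and>
    (\<forall>x \<in> M. mbounded (Group_Action.orbit G T x))"
  obtain x0 where x0: "x0 \<in> M" using assms(2) by blast
  have "Group_Action.orbit G T x0 \<noteq> {}"
    using * group.is_monoid[of G] monoid.one_closed[of G] by (auto simp: orbit_def)
  then obtain x where "x \<in> M" and fixed: "\<And>f. isometry f \<Longrightarrow> f ` M = M \<Longrightarrow>
      f ` Group_Action.orbit G T x0 = Group_Action.orbit G T x0 \<Longrightarrow> f x = x"
    using hyperconvex_common_fixed_point[OF assms(3)] * x0 by metis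
  have "T a x = x" if "a \<in> carrier G" for a
    using * that x0 fixed acts_on_image_eq acts_on_image_orbit by metis
  with \<open>x \<in> M\<close> show "Fix G M T \<noteq> {}" by (auto simp: Fix_def)
next
  interpret Metric_space M d by fact
  assume "mbounded M"
  \<comment> \<open>For \<open>S = M\<close> the invariance of \<open>S\<close> is surjectivity of
    \<open>f\<close>.\<close>
  then show "\<exists>x \<in> M. \<forall>f. isometry f \<and> f ` M = M \<longrightarrow> f x = x"
    using hyperconvex_common_fixed_point[OF assms(3) _ assms(2)] by metis
qed

end
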